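(* There is an absolute constant $C>0$ such that the following holds. Let $w$ be a positive integer, let $s$ be the largest integer with $1 - (1-2^{-w})^s \le 1/2$, and let $n = sw$. Let $A = \{x \in \{0,1\}^n : \mathrm{Tribes}_{w,s}(x) = 1\}$ and let $A^* \subseteq \{0,1\}^n$ be any superset of $A$ with $|A^*| = 2^{n-1}$. Identify $\{0,1\}^{n-1}$ with $\{x \in \{0,1\}^n : x_n = 0\}$. Then there exists a bijection $\phi \colon \{0,1\}^{n-1} \to A^*$ such that $\mathbb{E}_{x \in \{0,1\}^{n-1}}[\mathrm{dist}(x,\phi(x))] \le C\log n$ (with $x$ uniform in $\{0,1\}^{n-1}$), and in particular $\mathrm{avgstretch}(\phi) \le 2C\log n + 1$.
   Context: $\mathrm{Tribes}_{w,s} \colon \{0,1\}^{sw} \to \{0,1\}$ is $\bigvee_{i=1}^s (x_{(i-1)w+1} \wedge \dots \wedge x_{iw})$, i.e. the inputs are partitioned into $s$ consecutive blocks of size $w$ and the value is 1 iff some block is all ones. $\mathrm{dist}$ is the Hamming distance, and for a bijection $\phi \colon \{0,1\}^{n-1} \to A^*$, $\mathrm{avgstretch}(\phi) = \mathbb{E}[\mathrm{dist}(\phi(x),\phi(x'))]$ over a uniformly random pair $x,x' \in \{0,1\}^{n-1}$ differing in exactly one coordinate.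
   Formalization: The case n = 1 (that is, w = 1) is excluded by assuming n > 1: there s = 1, A* = {1}, the only bijection moves 0 to 1 at distance 1 > C log 1 = 0, and avgstretch averages over no pairs; for all w ≥ 2 one has n ≥ 2. *)

theory Defs
  imports "HOL-Probability.Probability_Mass_Function"
begin

definition cube :: "nat \<Rightarrow> bool list set" where
  "cube n = {x. length x = n}"

text \<open>Coordinates are numbered from 0, so block \<open>i < s\<close> occupies positions
  \<open>i * w, \<dots>, i * w + (w - 1)\<close>.\<close>

definition tribes :: "nat \<Rightarrow> nat \<Rightarrow> bool list \<Rightarrow> bool" where
  "tribes w s x \<longleftrightarrow> (\<exists>i<s. \<forall>j<w. x ! (i * w + j))"

text \<open>Only meaningful for lists of equal length.\<close>

definition hamming_dist :: "bool list \<Rightarrow> bool list \<Rightarrow> nat" where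
  "hamming_dist x y = card {i. i < length x \<and> x ! i \<noteq> y ! i}"

text \<open>The set of ordered pairs below is nonempty exactly if \<open>m \<ge> 1\<close>; for \<open>m = 0\<close> the
  average is unspecified.\<close>

definition avgstretch :: "nat \<Rightarrow> (bool list \<Rightarrow> bool list) \<Rightarrow> real" where
  "avgstretch m \<phi> =
     measure_pmf.expectation
       (pmf_of_set {(x, x'). x \<in> cube m \<and> x' \<in> cube m \<and> hamming_dist x x' = 1})
       (\<lambda>(x, x'). real (hamming_dist (\<phi> x) (\<phi> x')))"

definition tribes_threshold :: "nat \<Rightarrow> nat \<Rightarrow> bool" where
  "tribes_threshold w s \<longleftrightarrow>
     1 - (1 - 1 / 2 ^ w) ^ s \<le> (1 / 2 :: real) \<and>
     (\<forall>t. 1 - (1 - 1 / 2 ^ w) ^ t \<le> (1 / 2 :: real) \<longrightarrow> t \<le> s)"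

text \<open>The point \<open>x \<in> {0,1}\<^sup>n\<^sup>-\<^sup>1\<close> is identified with \<open>x @ [False] \<in> {0,1}\<^sup>n\<close>. For \<open>w = 1\<close> one gets
  \<open>s = n = 1\<close>, \<open>log n = 0\<close>, and the only bijection sends \<open>0\<close> to \<open>1\<close>, at distance 1; there are
  also no pairs to average over in the stretch. This degenerate case has to be excluded when
  bounding by a multiple of \<open>log n\<close>, by requiring \<open>n > 1\<close>.\<close>

end

theory Submission
  imports Defs
begin

text \<open>By Birkhoff's theorem it suffices to find a fractional bijection (a doubly stochastic matrix)
  of small total cost. Let \<open>D\<close> be the set of points without an all-ones block; it has density about
  one half. Picking a uniform point of \<open>D\<close> and setting each block independently to all ones with
  probability \<open>2\<^sup>-\<^sup>w\<close> gives a uniform point of the cube, changing \<open>s / 2\<^sup>w \<le> 1\<close> blocks on average, so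
  at an average cost of at most \<open>w = O(log n)\<close>. Restricted to targets outside \<open>D\<close> this transports
  mass from \<open>D\<close> evenly onto the tribes set. The set \<open>Astar - A\<close> has density \<open>O(2\<^sup>-\<^sup>w)\<close>, so even at the
  maximal distance \<open>n = s * w\<close> filling it costs only \<open>O(w)\<close>. Finally, merging the points \<open>x @ [False]\<close>
  and \<open>x @ [True]\<close> costs at most 1.\<close>

section \<open>Doubly stochastic matrices and cheap bijections\<close>

text \<open>Halmos-Vaughan induction on \<open>X\<close>. If a nonempty proper subset
  \<open>S\<close> is tight, match \<open>S\<close> first and the rest outside its neighbourhood. If
  none is tight, every nonempty proper subset has slack, so one point can be matched to any of its
  neighbours.\<close>

lemma hall_marriage:
  fixes N :: "'a \<Rightarrow> 'b set"
  assumes "finite X" and "\<And>x. x \<in> X \<Longrightarrow> finite (N x)"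
    and "\<And>S. S \<subseteq> X \<Longrightarrow> card S \<le> card (\<Union>x\<in>S. N x)"
  shows "\<exists>f. inj_on f X \<and> (\<forall>x\<in>X. f x \<in> N x)"
  using assms
proof (induction X arbitrary: N rule: finite_psubset_induct)
  case (psubset X)
  have finU: "finite (\<Union>x\<in>S. N x)" if "S \<subseteq> X" for S
    using that psubset.prems(1) psubset.hyps by (meson finite_UN_I finite_subset subsetD)
  show ?case
  proof (cases "\<exists>S. S \<subset> X \<and> S \<noteq> {} \<and> card (\<Union>x\<in>S. N x) = card S")
    case True
    then obtain S where S: "S \<subset> X" "S \<noteq> {}" "card (\<Union>x\<in>S. N x) = card S" by blast
    define U where "U = (\<Union>x\<in>S. N x)"
    have finS: "finite S" and finX: "finite X" using S psubset.hyps by (auto intro: finite_subset)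
    have "\<exists>f. inj_on f S \<and> (\<forall>x\<in>S. f x \<in> N x)"
      using S(1) psubset.prems by (intro psubset.IH) auto
    then obtain f where f: "inj_on f S" "\<And>x. x \<in> S \<Longrightarrow> f x \<in> N x" by blast
    have "\<exists>g. inj_on g (X - S) \<and> (\<forall>x\<in>X - S. g x \<in> N x - U)"
    proof (rule psubset.IH)
      show "X - S \<subset> X" using S by auto
      show "finite (N x - U)" if "x \<in> X - S" for x using that psubset.prems(1) by auto
      fix T assume T: "T \<subseteq> X - S"
      \<comment> \<open>Tightness of \<open>S\<close> cancels: Hall's condition for the union of
        \<open>T\<close> and \<open>S\<close>, minus \<open>card U = card S\<close>, is the
        condition for \<open>T\<close> with \<open>U\<close> removed.\<close>
      have "card T + card S = card (T \<union> S)"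
        using T finS finX by (subst card_Un_disjoint) (auto intro: finite_subset)
      also have "\<dots> \<le> card (\<Union>x\<in>T \<union> S. N x)" using T S by (intro psubset.prems(2)) auto
      also have "(\<Union>x\<in>T \<union> S. N x) = (\<Union>x\<in>T. N x - U) \<union> U" by (auto simp: U_def)
      also have "card \<dots> \<le> card (\<Union>x\<in>T. N x - U) + card U" by (rule card_Un_le)
      finally show "card T \<le> card (\<Union>x\<in>T. N x - U)" using S(3) by (simp add: U_def)
    qed
    then obtain g where g: "inj_on g (X - S)" "\<And>x. x \<in> X - S \<Longrightarrow> g x \<in> N x - U" by blast
    define h where "h x = (if x \<in> S then f x else g x)" for x
    have fU: "f x \<in> U" if "x \<in> S" for x using f(2) that by (auto simp: U_def)
    have "inj_on h X"
    proof (rule inj_onI)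
      fix x y assume "x \<in> X" "y \<in> X" "h x = h y"
      then show "x = y"
        using fU g(2)[of x] g(2)[of y] fU[of x] fU[of y] inj_onD[OF f(1), of x y] inj_onD[OF g(1), of x y]
        by (cases "x \<in> S"; cases "y \<in> S") (auto simp: h_def)
    qed
    moreover have "\<forall>x\<in>X. h x \<in> N x" using f(2) g(2) by (auto simp: h_def)
    ultimately show ?thesis by blast
  next
    case False
    show ?thesis
    proof (cases "X = {}")
      case False
      then obtain x where x: "x \<in> X" by blast
      have "card {x} \<le> card (\<Union>z\<in>{x}. N z)" using x by (intro psubset.prems(2)) auto
      then have "N x \<noteq> {}" by auto
      then obtain y where y: "y \<in> N x" by blast
      have "\<exists>g. inj_on g (X - {x}) \<and> (\<forall>z\<in>X - {x}. g z \<in> N z - {y})"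
      proof (rule psubset.IH)
        show "X - {x} \<subset> X" using x by auto
        show "finite (N z - {y})" if "z \<in> X - {x}" for z using that psubset.prems(1) by auto
        fix T assume T: "T \<subseteq> X - {x}"
        show "card T \<le> card (\<Union>z\<in>T. N z - {y})"
        proof (cases "T = {}")
          case False
          have TX: "T \<subset> X" using T x by auto
          then have "card T \<le> card (\<Union>z\<in>T. N z)" by (intro psubset.prems(2)) auto
          moreover have "card (\<Union>z\<in>T. N z) \<noteq> card T"
            using False TX \<open>\<not> (\<exists>S. S \<subset> X \<and> S \<noteq> {} \<and> card (\<Union>x\<in>S. N x) = card S)\<close> by blast
          moreover have "card (\<Union>z\<in>T. N z) \<le> card ((\<Union>z\<in>T. N z) - {y}) + 1"
            using finU[of T] TX by (auto simp: card_Diff_singleton_if)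
          ultimately have "card T \<le> card ((\<Union>z\<in>T. N z) - {y})" by linarith
          also have "(\<Union>z\<in>T. N z) - {y} = (\<Union>z\<in>T. N z - {y})" by auto
          finally show ?thesis .
        qed auto
      qed
      then obtain g where g: "inj_on g (X - {x})" "\<And>z. z \<in> X - {x} \<Longrightarrow> g z \<in> N z - {y}" by blast
      have "inj_on (g(x := y)) X"
      proof (rule inj_onI)
        fix a b assume "a \<in> X" "b \<in> X" "(g(x := y)) a = (g(x := y)) b"
        then show "a = b"
          using g(2)[of a] g(2)[of b] inj_onD[OF g(1), of a b] by (auto split: if_splits)
      qed
      moreover have "\<forall>z\<in>X. (g(x := y)) z \<in> N z" using g(2) y by auto
      ultimately show ?thesis by blast
    qed auto
  qed
qed

text \<open>Hall's condition by counting mass: the rows of \<open>S\<close> carry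
  \<open>c * card S\<close>, all in columns of the neighbourhood \<open>U\<close>, which hold at
  most \<open>c * card U\<close>. Counting the total mass both ways gives
  \<open>card X = card Y\<close>. A general \<open>c\<close> is allowed because peeling off
  bijections shrinks the row sums.\<close>

lemma bij_betw_support:
  fixes M :: "'a \<Rightarrow> 'b \<Rightarrow> real"
  assumes "finite X" "finite Y" "c > 0"
    and nonneg: "\<And>x y. x \<in> X \<Longrightarrow> y \<in> Y \<Longrightarrow> M x y \<ge> 0"
    and row: "\<And>x. x \<in> X \<Longrightarrow> (\<Sum>y\<in>Y. M x y) = c"
    and col: "\<And>y. y \<in> Y \<Longrightarrow> (\<Sum>x\<in>X. M x y) = c"
  shows "\<exists>f. bij_betw f X Y \<and> (\<forall>x\<in>X. M x (f x) > 0)"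
proof -
  define N where "N x = {y \<in> Y. M x y > 0}" for x
  have "\<exists>f. inj_on f X \<and> (\<forall>x\<in>X. f x \<in> N x)"
  proof (rule hall_marriage)
    show "finite X" by fact
    show "finite (N x)" for x using assms(2) by (auto simp: N_def)
    fix S assume S: "S \<subseteq> X"
    define U where "U = (\<Union>x\<in>S. N x)"
    have U: "U \<subseteq> Y" by (auto simp: U_def N_def)
    have "c * card S = (\<Sum>x\<in>S. \<Sum>y\<in>Y. M x y)" using row S by (simp add: subset_iff mult.commute)
    also have "\<dots> = (\<Sum>x\<in>S. \<Sum>y\<in>U. M x y)"
    proof (rule sum.cong[OF refl], rule sum.mono_neutral_right)
      fix x assume "x \<in> S"
      then show "\<forall>y\<in>Y - U. M x y = 0"
        using nonneg[of x] S by (force simp: U_def N_def)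
    qed (use U assms in auto)
    also have "\<dots> = (\<Sum>y\<in>U. \<Sum>x\<in>S. M x y)" by (rule sum.swap)
    also have "\<dots> \<le> (\<Sum>y\<in>U. \<Sum>x\<in>X. M x y)"
      using S U assms(1) nonneg by (intro sum_mono sum_mono2) auto
    also have "\<dots> = c * card U" using col U by (simp add: subset_iff mult.commute)
    finally show "card S \<le> card (\<Union>x\<in>S. N x)" using \<open>c > 0\<close> by (simp add: U_def)
  qed
  then obtain f where f: "inj_on f X" "\<And>x. x \<in> X \<Longrightarrow> f x \<in> N x" by blast
  have "c * card X = (\<Sum>x\<in>X. \<Sum>y\<in>Y. M x y)" using row by (simp add: mult.commute)
  also have "\<dots> = (\<Sum>y\<in>Y. \<Sum>x\<in>X. M x y)" by (rule sum.swap)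
  also have "\<dots> = c * card Y" using col by (simp add: mult.commute)
  finally have "card X = card Y" using \<open>c > 0\<close> by simp
  moreover have "f ` X \<subseteq> Y" using f(2) by (auto simp: N_def)
  ultimately have "f ` X = Y" using f(1) assms(2) by (simp add: card_image card_subset_eq)
  then show ?thesis using f by (auto simp: bij_betw_def N_def)
qed

text \<open>Instead of an explicit convex combination of bijections, the induction on the number of
  positive entries keeps only what is needed: some bijection costs no more than the average.\<close>

lemma birkhoff_min_cost:
  fixes M d :: "'a \<Rightarrow> 'b \<Rightarrow> real"
  assumes "finite X" "finite Y" "c > 0"
    and "\<And>x y. x \<in> X \<Longrightarrow> y \<in> Y \<Longrightarrow> M x y \<ge> 0"
    and "\<And>x. x \<in> X \<Longrightarrow> (\<Sum>y\<in>Y. M x y) = c"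
    and "\<And>y. y \<in> Y \<Longrightarrow> (\<Sum>x\<in>X. M x y) = c"
  shows "\<exists>f. bij_betw f X Y \<and> c * (\<Sum>x\<in>X. d x (f x)) \<le> (\<Sum>x\<in>X. \<Sum>y\<in>Y. M x y * d x y)"
  using assms(3-)
proof (induction "card {p \<in> X \<times> Y. M (fst p) (snd p) > 0}" arbitrary: M c rule: less_induct)
  case less
  obtain f where f: "bij_betw f X Y" "\<And>x. x \<in> X \<Longrightarrow> M x (f x) > 0"
    using bij_betw_support[OF assms(1,2) less.prems] by blast
  have fY: "f x \<in> Y" if "x \<in> X" for x using f(1) that by (auto simp: bij_betw_def)
  show ?case
  proof (cases "X = {}")
    case True
    then show ?thesis using f(1) by (intro exI[of _ f]) auto
  next
    case False
    \<comment> \<open>The largest multiple of the bijection \<open>f\<close> that can be subtracted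
      from \<open>M\<close>. The entry at \<open>x0\<close> becomes zero, so the support shrinks
      strictly.\<close>
    define m where "m = Min ((\<lambda>x. M x (f x)) ` X)"
    have mle: "m \<le> M x (f x)" if "x \<in> X" for x using assms(1) that by (auto simp: m_def)
    have "m \<in> (\<lambda>x. M x (f x)) ` X" using assms(1) False unfolding m_def by (intro Min_in) auto
    then obtain x0 where x0: "x0 \<in> X" "M x0 (f x0) = m" by auto
    have mpos: "m > 0" using f(2) x0 by auto
    define M' where "M' x y = M x y - (if y = f x then m else 0)" for x y
    have nn': "M' x y \<ge> 0" if "x \<in> X" "y \<in> Y" for x y
      using mle[of x] less.prems(2)[of x y] that by (auto simp: M'_def)
    have row': "(\<Sum>y\<in>Y. M' x y) = c - m" if "x \<in> X" for x
      using fY[OF that] less.prems(3)[OF that] assms(2) by (simp add: M'_def sum_subtractf)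
    have col': "(\<Sum>x\<in>X. M' x y) = c - m" if y: "y \<in> Y" for y
    proof -
      obtain a where a: "a \<in> X" "f a = y" using f(1) y by (auto simp: bij_betw_def)
      have "(\<Sum>x\<in>X. if y = f x then m else 0) = (\<Sum>x\<in>X. if x = a then m else 0)"
        using a f(1) by (intro sum.cong) (auto simp: bij_betw_def inj_on_def)
      then show ?thesis using a less.prems(4)[OF y] assms(1) by (simp add: M'_def sum_subtractf)
    qed
    have cost': "(\<Sum>x\<in>X. \<Sum>y\<in>Y. M' x y * d x y)
        = (\<Sum>x\<in>X. \<Sum>y\<in>Y. M x y * d x y) - m * (\<Sum>x\<in>X. d x (f x))"
    proof -
      have "(\<Sum>y\<in>Y. M' x y * d x y) = (\<Sum>y\<in>Y. M x y * d x y) - m * d x (f x)" if "x \<in> X" for x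
      proof -
        have "(\<Sum>y\<in>Y. M' x y * d x y)
            = (\<Sum>y\<in>Y. M x y * d x y - (if y = f x then m * d x (f x) else 0))"
          by (intro sum.cong) (auto simp: M'_def algebra_simps)
        then show ?thesis using fY[OF that] assms(2) by (simp add: sum_subtractf)
      qed
      then show ?thesis by (simp add: sum_subtractf sum_distrib_left)
    qed
    have mc: "m \<le> c"
      using member_le_sum[of "f x0" Y "M x0"] fY x0 less.prems(2,3) assms(2) by auto
    show ?thesis
    \<comment> \<open>If \<open>m = c\<close>, the remainder vanishes and \<open>f\<close> carries
      the whole cost; the induction hypothesis would need a positive row sum.\<close>
    proof (cases "m = c")
      case True
      have "0 = M' x y" if "x \<in> X" "y \<in> Y" for x y
        using row'[OF that(1)] nn' that assms(2) True by (simp add: sum_nonneg_eq_0_iff)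
      then have "(\<Sum>x\<in>X. \<Sum>y\<in>Y. M' x y * d x y) = 0" by (auto intro!: sum.neutral)
      then show ?thesis using cost' f(1) True by (intro exI[of _ f]) auto
    next
      case False
      have "{p \<in> X \<times> Y. M' (fst p) (snd p) > 0} \<subset> {p \<in> X \<times> Y. M (fst p) (snd p) > 0}"
      proof
        show "{p \<in> X \<times> Y. M' (fst p) (snd p) > 0} \<subseteq> {p \<in> X \<times> Y. M (fst p) (snd p) > 0}"
          using mpos by (auto simp: M'_def split: if_splits)
        have "(x0, f x0) \<in> {p \<in> X \<times> Y. M (fst p) (snd p) > 0}" using x0 f(2) fY by auto
        moreover have "(x0, f x0) \<notin> {p \<in> X \<times> Y. M' (fst p) (snd p) > 0}"
          using x0 by (auto simp: M'_def)
        ultimately show "{p \<in> X \<times> Y. M' (fst p) (snd p) > 0} \<noteq> {p \<in> X \<times> Y. M (fst p) (snd p) > 0}"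
          by blast
      qed
      then have "card {p \<in> X \<times> Y. M' (fst p) (snd p) > 0} < card {p \<in> X \<times> Y. M (fst p) (snd p) > 0}"
        using assms(1,2) by (intro psubset_card_mono) auto
      then have "\<exists>g. bij_betw g X Y \<and>
          (c - m) * (\<Sum>x\<in>X. d x (g x)) \<le> (\<Sum>x\<in>X. \<Sum>y\<in>Y. M' x y * d x y)"
        using mc False nn' row' col' by (intro less.hyps) auto
      then obtain g where g: "bij_betw g X Y"
          "(c - m) * (\<Sum>x\<in>X. d x (g x)) \<le> (\<Sum>x\<in>X. \<Sum>y\<in>Y. M' x y * d x y)" by blast
      let ?F = "\<Sum>x\<in>X. d x (f x)" and ?G = "\<Sum>x\<in>X. d x (g x)"
      \<comment> \<open>The weights add up to \<open>c\<close>, so the cheaper of \<open>f\<close>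
        and \<open>g\<close> satisfies the bound.\<close>
      have mix: "(c - m) * ?G + m * ?F \<le> (\<Sum>x\<in>X. \<Sum>y\<in>Y. M x y * d x y)" using g(2) cost' by simp
      show ?thesis
      proof (cases "?F \<le> ?G")
        case True
        then have "(c - m) * ?F \<le> (c - m) * ?G" using mc by (intro mult_left_mono) auto
        then show ?thesis using mix f(1) by (intro exI[of _ f]) (auto simp: algebra_simps)
      next
        case False
        then have "m * ?G \<le> m * ?F" using mpos by (intro mult_left_mono) auto
        then show ?thesis using mix g(1) by (intro exI[of _ g]) (auto simp: algebra_simps)
      qed
    qed
  qed
qed

section \<open>The Hamming cube\<close>

text \<open>In this form, additivity over concatenation is immediate from \<open>zip\<close> and
  \<open>filter\<close> on appended lists.\<close>

lemma hamming_dist_conv_filter: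
  assumes "length x = length y"
  shows "hamming_dist x y = length (filter (\<lambda>(a, b). a \<noteq> b) (zip x y))"
  unfolding hamming_dist_def length_filter_conv_card using assms
  by (intro arg_cong[where f = card]) auto

lemma hamming_dist_append:
  assumes "length u = length u'" "length v = length v'"
  shows "hamming_dist (u @ v) (u' @ v') = hamming_dist u u' + hamming_dist v v'"
  using assms by (simp add: hamming_dist_conv_filter)

lemma hamming_dist_refl [simp]: "hamming_dist x x = 0"
  by (simp add: hamming_dist_def)

lemma hamming_dist_le_length: "hamming_dist x y \<le> length x"
proof -
  have "hamming_dist x y \<le> card {..<length x}"
    unfolding hamming_dist_def by (intro card_mono) auto
  then show ?thesis by simp
qed

lemma hamming_dist_commute: "length x = length y \<Longrightarrow> hamming_dist x y = hamming_dist y x"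
  unfolding hamming_dist_def by (intro arg_cong[where f = card]) auto

lemma hamming_dist_triangle:
  assumes "length x = length y"
  shows "hamming_dist x z \<le> hamming_dist x y + hamming_dist y z"
proof -
  have "hamming_dist x z
      \<le> card ({i. i < length x \<and> x ! i \<noteq> y ! i} \<union> {i. i < length y \<and> y ! i \<noteq> z ! i})"
    unfolding hamming_dist_def using assms by (intro card_mono) auto
  also have "\<dots> \<le> hamming_dist x y + hamming_dist y z"
    unfolding hamming_dist_def by (rule card_Un_le)
  finally show ?thesis .
qed

lemma finite_cube [simp]: "finite (cube n)"
  using finite_lists_length_eq[of "UNIV :: bool set" n] by (simp add: cube_def)

lemma card_cube: "card (cube n) = 2 ^ n"
  using card_lists_length_eq[of "UNIV :: bool set" n] by (simp add: cube_def)

lemma cube_0 [simp]: "cube 0 = {[]}"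
  by (auto simp: cube_def)

lemma append_in_cube: "u \<in> cube a \<Longrightarrow> v \<in> cube b \<Longrightarrow> u @ v \<in> cube (a + b)"
  by (simp add: cube_def)

lemma sum_append_product:
  fixes f :: "bool list \<Rightarrow> 'b::comm_monoid_add"
  assumes "U \<subseteq> cube a"
  shows "sum f ((\<lambda>(u, v). u @ v) ` (U \<times> V)) = (\<Sum>u\<in>U. \<Sum>v\<in>V. f (u @ v))"
proof -
  have "inj_on (\<lambda>(u, v). u @ v) (U \<times> V)"
    using assms by (auto simp: inj_on_def cube_def subset_iff)
  then show ?thesis by (simp add: sum.reindex sum.cartesian_product case_prod_unfold)
qed

lemma cube_add: "cube (a + b) = (\<lambda>(u, v). u @ v) ` (cube a \<times> cube b)"
proof (intro subset_antisym subsetI)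
  fix x assume "x \<in> cube (a + b)"
  then have "x = (\<lambda>(u, v). u @ v) (take a x, drop a x)"
    "(take a x, drop a x) \<in> cube a \<times> cube b" by (auto simp: cube_def)
  then show "x \<in> (\<lambda>(u, v). u @ v) ` (cube a \<times> cube b)" by blast
qed (auto simp: append_in_cube)

lemma neighbours_cube:
  assumes "x \<in> cube m"
  shows "{y \<in> cube m. hamming_dist x y = 1} = (\<lambda>i. x[i := \<not> x ! i]) ` {..<m}"
proof (intro subset_antisym subsetI)
  fix y assume y: "y \<in> {y \<in> cube m. hamming_dist x y = 1}"
  then obtain i where i: "{i. i < length x \<and> x ! i \<noteq> y ! i} = {i}"
    by (auto simp: hamming_dist_def card_1_singleton_iff)
  have "y = x[i := \<not> x ! i]"
  proof (rule nth_equalityI)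
    show "length y = length (x[i := \<not> x ! i])" using y assms by (simp add: cube_def)
    fix j assume "j < length y"
    then have j: "j < length x" using y assms by (simp add: cube_def)
    have "x ! j \<noteq> y ! j \<longleftrightarrow> j = i" using i j by blast
    then show "y ! j = x[i := \<not> x ! i] ! j" using j by (auto simp: nth_list_update)
  qed
  moreover have "i < m" using i assms by (auto simp: cube_def)
  ultimately show "y \<in> (\<lambda>i. x[i := \<not> x ! i]) ` {..<m}" by blast
next
  fix y assume "y \<in> (\<lambda>i. x[i := \<not> x ! i]) ` {..<m}"
  then obtain i where i: "i < m" and y: "y = x[i := \<not> x ! i]" by blast
  have "{j. j < length x \<and> x ! j \<noteq> y ! j} = {i}"
    using i assms by (auto simp: cube_def y nth_list_update)
  then show "y \<in> {y \<in> cube m. hamming_dist x y = 1}"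
    using assms by (simp add: hamming_dist_def cube_def y)
qed

lemma card_neighbours_cube:
  assumes "x \<in> cube m"
  shows "card {y \<in> cube m. hamming_dist x y = 1} = m"
proof -
  have "inj_on (\<lambda>i. x[i := \<not> x ! i]) {..<m}"
  proof (rule inj_onI)
    fix i j assume "i \<in> {..<m}" "j \<in> {..<m}" "x[i := \<not> x ! i] = x[j := \<not> x ! j]"
    then have "x[i := \<not> x ! i] ! i = x[j := \<not> x ! j] ! i" "i < length x"
      using assms by (auto simp: cube_def)
    then show "i = j" by (cases "i = j") auto
  qed
  then show ?thesis unfolding neighbours_cube[OF assms] by (simp add: card_image)
qed

text \<open>For an edge, go from \<open>\<phi> x\<close> to \<open>x @ [False]\<close>, across the
  edge, and on to \<open>\<phi> y\<close>: two displacements plus 1. The cube is regular of degree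
  \<open>m\<close>, so each end of a uniform edge is a uniform vertex.\<close>

lemma avgstretch_le_twice_avg_displacement:
  assumes "m > 0" and \<phi>: "\<And>x. x \<in> cube m \<Longrightarrow> \<phi> x \<in> cube (Suc m)"
  shows "avgstretch m \<phi> \<le>
    2 * measure_pmf.expectation (pmf_of_set (cube m)) (\<lambda>x. real (hamming_dist (x @ [False]) (\<phi> x))) + 1"
proof -
  define nb where "nb x = {y \<in> cube m. hamming_dist x y = 1}" for x
  define S where "S = Sigma (cube m) nb"
  define g where "g x = real (hamming_dist (x @ [False]) (\<phi> x))" for x
  have S_eq: "{(x, x'). x \<in> cube m \<and> x' \<in> cube m \<and> hamming_dist x x' = 1} = S"
    by (auto simp: S_def nb_def)
  have fin: "finite S" by (auto simp: S_def nb_def)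
  have cnb: "card (nb x) = m" if "x \<in> cube m" for x
    using card_neighbours_cube[OF that] by (simp add: nb_def)
  have cS: "card S = m * 2 ^ m"
    unfolding S_def using cnb by (subst card_SigmaI) (auto simp: nb_def card_cube)
  have "S \<noteq> {}" using cS assms(1) by auto
  have cube_ne: "cube m \<noteq> {}" using card_cube[of m] by auto
  have s1: "(\<Sum>(x, x')\<in>S. g x) = m * (\<Sum>x\<in>cube m. g x)"
    unfolding S_def using cnb
    by (subst sum.Sigma[symmetric]) (auto simp: nb_def sum_distrib_left)
  \<comment> \<open>Edges are ordered pairs, so exchanging the ends permutes
    \<open>S\<close>.\<close>
  have s2: "(\<Sum>(x, x')\<in>S. g x') = (\<Sum>(x, x')\<in>S. g x)"
    by (rule sum.reindex_bij_witness[of _ prod.swap prod.swap])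
      (auto simp: S_def nb_def cube_def hamming_dist_commute)
  have "avgstretch m \<phi> = (\<Sum>(x, x')\<in>S. real (hamming_dist (\<phi> x) (\<phi> x'))) / card S"
    unfolding avgstretch_def S_eq using fin \<open>S \<noteq> {}\<close> by (simp add: integral_pmf_of_set)
  also have "\<dots> \<le> (\<Sum>(x, x')\<in>S. g x + g x' + 1) / card S"
  proof (intro divide_right_mono sum_mono)
    fix p assume "p \<in> S"
    then obtain x y where p: "p = (x, y)" and x: "x \<in> cube m" and y: "y \<in> cube m"
      and xy: "hamming_dist x y = 1" by (auto simp: S_def nb_def)
    have len: "length x = m" "length y = m" "length (\<phi> x) = Suc m" "length (\<phi> y) = Suc m"
      using x y \<phi>[OF x] \<phi>[OF y] by (auto simp: cube_def)
    have "hamming_dist (\<phi> x) (\<phi> y)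
        \<le> hamming_dist (\<phi> x) (x @ [False]) + hamming_dist (x @ [False]) (\<phi> y)"
      using len by (intro hamming_dist_triangle) auto
    also have "hamming_dist (x @ [False]) (\<phi> y)
        \<le> hamming_dist (x @ [False]) (y @ [False]) + hamming_dist (y @ [False]) (\<phi> y)"
      using len by (intro hamming_dist_triangle) auto
    also have "hamming_dist (x @ [False]) (y @ [False]) = 1"
      using xy len by (simp add: hamming_dist_append)
    also have "hamming_dist (\<phi> x) (x @ [False]) = hamming_dist (x @ [False]) (\<phi> x)"
      using len by (intro hamming_dist_commute) auto
    finally show "(case p of (x, x') \<Rightarrow> real (hamming_dist (\<phi> x) (\<phi> x')))
        \<le> (case p of (x, x') \<Rightarrow> g x + g x' + 1)" by (simp add: p g_def)
  qed auto
  also have "(\<Sum>(x, x')\<in>S. g x + g x' + 1) = 2 * m * (\<Sum>x\<in>cube m. g x) + card S"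
  proof -
    have "(\<Sum>(x, x')\<in>S. g x + g x' + 1) = (\<Sum>(x, x')\<in>S. g x) + (\<Sum>(x, x')\<in>S. g x') + (\<Sum>(x, x')\<in>S. 1)"
      by (simp add: case_prod_unfold sum.distrib)
    then show ?thesis using s1 s2 by simp
  qed
  also have "(2 * m * (\<Sum>x\<in>cube m. g x) + card S) / card S = 2 * ((\<Sum>x\<in>cube m. g x) / 2 ^ m) + 1"
    using assms(1) by (simp add: cS field_simps)
  also have "(\<Sum>x\<in>cube m. g x) / 2 ^ m = measure_pmf.expectation (pmf_of_set (cube m)) g"
    using cube_ne by (simp add: integral_pmf_of_set card_cube)
  finally show ?thesis unfolding g_def .
qed

section \<open>Tribes\<close>

definition nontribes :: "nat \<Rightarrow> nat \<Rightarrow> bool list set" where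
  "nontribes w s = {x \<in> cube (s * w). \<not> tribes w s x}"

lemma tribes_append:
  assumes "u \<in> cube w"
  shows "tribes w (Suc s) (u @ v) \<longleftrightarrow> u = replicate w True \<or> tribes w s v"
proof -
  have "(\<exists>i<Suc s. \<forall>j<w. (u @ v) ! (i * w + j))
      \<longleftrightarrow> (\<forall>j<w. (u @ v) ! j) \<or> (\<exists>i<s. \<forall>j<w. (u @ v) ! (Suc i * w + j))"
    by (subst Ex_less_Suc2) simp
  moreover have "(\<forall>j<w. (u @ v) ! j) \<longleftrightarrow> u = replicate w True"
    using assms by (auto simp: cube_def nth_append list_eq_iff_nth_eq)
  moreover have "(u @ v) ! (Suc i * w + j) = v ! (i * w + j)" for i j
    using assms by (simp add: cube_def nth_append)
  ultimately show ?thesis unfolding tribes_def by simp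
qed

lemma nontribes_0 [simp]: "nontribes w 0 = {[]}"
  by (auto simp: nontribes_def tribes_def)

text \<open>The set is a product over blocks; counting, marginals and cost all follow by induction
  along this factorization.\<close>

lemma nontribes_Suc:
  "nontribes w (Suc s) = (\<lambda>(u, v). u @ v) ` ((cube w - {replicate w True}) \<times> nontribes w s)"
proof -
  have "nontribes w (Suc s) = {x \<in> (\<lambda>(u, v). u @ v) ` (cube w \<times> cube (s * w)). \<not> tribes w (Suc s) x}"
    by (simp add: nontribes_def flip: cube_add)
  also have "\<dots> = (\<lambda>(u, v). u @ v) ` ((cube w - {replicate w True}) \<times> nontribes w s)"
    by (auto simp: tribes_append nontribes_def)
  finally show ?thesis .
qed

lemma finite_nontribes [simp]: "finite (nontribes w s)"
  by (simp add: nontribes_def)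

lemma ones_in_cube [simp]: "replicate w True \<in> cube w"
  by (simp add: cube_def)

lemma card_cube_minus_ones: "real (card (cube w - {replicate w True})) = 2 ^ w - 1"
  by (simp add: card_Diff_singleton card_cube of_nat_diff)

lemma card_nontribes: "real (card (nontribes w s)) = (2 ^ w - 1) ^ s"
proof (induction s)
  case (Suc s)
  have "real (card (nontribes w (Suc s))) = (\<Sum>x\<in>nontribes w (Suc s). 1)" by simp
  also have "\<dots> = (\<Sum>u\<in>cube w - {replicate w True}. \<Sum>v\<in>nontribes w s. 1)"
    unfolding nontribes_Suc by (rule sum_append_product) auto
  finally show ?case using Suc card_cube_minus_ones[of w] by (simp add: card_Diff_singleton)
qed simp

section \<open>The block-filling kernel: marginals and cost\<close>

text \<open>The kernel couples a uniform point without all-ones blocks to a uniform point of the cube: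
  the second point arises from the first by setting a random set of blocks to all ones.\<close>

definition block_kernel :: "nat \<Rightarrow> bool list \<Rightarrow> bool list \<Rightarrow> real" where
  "block_kernel w u u' =
     (if u' = u then 1 else if u' = replicate w True then 1 / (2 ^ w - 1) else 0)"

text \<open>The weights are normalized by columns, not by rows. In a normalized row a block is
  raised to all ones with probability
  \<open>(1 / (2 ^ w - 1)) / (2 ^ w / (2 ^ w - 1)) = 1 / 2 ^ w\<close>, independently of the
  others.\<close>

fun tribes_kernel :: "nat \<Rightarrow> nat \<Rightarrow> bool list \<Rightarrow> bool list \<Rightarrow> real" where
  "tribes_kernel w 0 x y = 1"
| "tribes_kernel w (Suc s) x y =
     block_kernel w (take w x) (take w y) * tribes_kernel w s (drop w x) (drop w y)"

lemma tribes_kernel_append: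
  assumes "u \<in> cube w" "u' \<in> cube w"
  shows "tribes_kernel w (Suc s) (u @ v) (u' @ v') = block_kernel w u u' * tribes_kernel w s v v'"
  using assms by (simp add: cube_def)

lemma block_kernel_nonneg: "block_kernel w u u' \<ge> 0"
  by (simp add: block_kernel_def)

lemma tribes_kernel_nonneg: "tribes_kernel w s x y \<ge> 0"
  by (induction s arbitrary: x y) (auto simp: block_kernel_nonneg)

lemma sum_block_kernel:
  fixes g :: "bool list \<Rightarrow> real"
  assumes "u \<in> cube w - {replicate w True}"
  shows "(\<Sum>u'\<in>cube w. block_kernel w u u' * g u') = g u + g (replicate w True) / (2 ^ w - 1)"
proof -
  have "(\<Sum>u'\<in>cube w. block_kernel w u u' * g u')
      = (\<Sum>u'\<in>cube w. (if u' = u then g u else 0)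
          + (if u' = replicate w True then g (replicate w True) / (2 ^ w - 1) else 0))"
    using assms by (intro sum.cong) (auto simp: block_kernel_def)
  then show ?thesis using assms by (simp add: sum.distrib)
qed

lemma block_kernel_row:
  assumes "w > 0" "u \<in> cube w - {replicate w True}"
  shows "(\<Sum>u'\<in>cube w. block_kernel w u u') = 2 ^ w / (2 ^ w - 1)"
proof -
  have "(2::real) ^ w > 1" using assms(1) by simp
  then show ?thesis using sum_block_kernel[OF assms(2), of "\<lambda>_. 1"] by (simp add: field_simps)
qed

text \<open>The all-ones block receives \<open>1 / (2 ^ w - 1)\<close> from each of the
  \<open>2 ^ w - 1\<close> other blocks; any other block receives 1 from itself.\<close>

lemma block_kernel_col:
  assumes "w > 0" "u' \<in> cube w"
  shows "(\<Sum>u\<in>cube w - {replicate w True}. block_kernel w u u') = 1"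
proof (cases "u' = replicate w True")
  case True
  have gt: "(2::real) ^ w > 1" using assms(1) by simp
  have "(\<Sum>u\<in>cube w - {replicate w True}. block_kernel w u u')
      = (\<Sum>u\<in>cube w - {replicate w True}. 1 / (2 ^ w - 1))"
    using True by (intro sum.cong) (auto simp: block_kernel_def)
  also have "\<dots> = real (card (cube w - {replicate w True})) * (1 / (2 ^ w - 1))" by simp
  finally show ?thesis unfolding card_cube_minus_ones using gt by simp
next
  case False
  have "(\<Sum>u\<in>cube w - {replicate w True}. block_kernel w u u')
      = (\<Sum>u\<in>cube w - {replicate w True}. if u = u' then 1 else 0)"
    using False by (intro sum.cong) (auto simp: block_kernel_def)
  then show ?thesis using False assms(2) by simp
qed

text \<open>Only mass moved to the all-ones block costs anything: one unit in total, over a distance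
  of at most \<open>w\<close>.\<close>

lemma block_kernel_cost:
  assumes "w > 0"
  shows "(\<Sum>u\<in>cube w - {replicate w True}. \<Sum>u'\<in>cube w. block_kernel w u u' * hamming_dist u u')
           \<le> w"
proof -
  have gt: "(2::real) ^ w > 1" using assms by simp
  have "(\<Sum>u\<in>cube w - {replicate w True}. \<Sum>u'\<in>cube w. block_kernel w u u' * hamming_dist u u')
      = (\<Sum>u\<in>cube w - {replicate w True}. hamming_dist u (replicate w True) / (2 ^ w - 1))"
    by (intro sum.cong) (auto simp: sum_block_kernel)
  also have "\<dots> \<le> (\<Sum>u\<in>cube w - {replicate w True}. w / (2 ^ w - 1))"
    using gt hamming_dist_le_length
    by (intro sum_mono divide_right_mono) (auto simp: cube_def)
  also have "\<dots> = real (card (cube w - {replicate w True})) * (w / (2 ^ w - 1))" by simp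
  also have "\<dots> = w" unfolding card_cube_minus_ones using gt by simp
  finally show ?thesis .
qed

text \<open>The test function \<open>g\<close> is constantly 1 for row sums and the distance for the
  cost.\<close>

lemma sum_kernel_append:
  fixes g :: "bool list \<Rightarrow> real"
  assumes "u \<in> cube w"
  shows "(\<Sum>y\<in>cube (Suc s * w). tribes_kernel w (Suc s) (u @ v) y * g y)
     = (\<Sum>u'\<in>cube w. \<Sum>v'\<in>cube (s * w).
          block_kernel w u u' * tribes_kernel w s v v' * g (u' @ v'))"
proof -
  have "cube (Suc s * w) = (\<lambda>(u, v). u @ v) ` (cube w \<times> cube (s * w))" by (simp add: cube_add)
  then show ?thesis
    using assms by (simp add: sum_append_product[of _ w] tribes_kernel_append del: tribes_kernel.simps)
qed

lemma tribes_kernel_row: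
  assumes "w > 0" "x \<in> nontribes w s"
  shows "(\<Sum>y\<in>cube (s * w). tribes_kernel w s x y) = (2 ^ w / (2 ^ w - 1)) ^ s"
  using assms(2)
proof (induction s arbitrary: x)
  case (Suc s)
  then obtain u v where x: "x = u @ v" and u: "u \<in> cube w - {replicate w True}"
    and v: "v \<in> nontribes w s" by (auto simp: nontribes_Suc)
  have "(\<Sum>y\<in>cube (Suc s * w). tribes_kernel w (Suc s) x y)
      = (\<Sum>u'\<in>cube w. \<Sum>v'\<in>cube (s * w). block_kernel w u u' * tribes_kernel w s v v')"
    using sum_kernel_append[of u w s v "\<lambda>_. 1"] u by (simp add: x del: tribes_kernel.simps)
  also have "\<dots> = (2 ^ w / (2 ^ w - 1)) ^ Suc s"
    using Suc.IH[OF v] block_kernel_row[OF assms(1) u]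
    by (simp add: sum_product[symmetric])
  finally show ?case .
qed simp

lemma tribes_kernel_col:
  assumes "w > 0" "y \<in> cube (s * w)"
  shows "(\<Sum>x\<in>nontribes w s. tribes_kernel w s x y) = 1"
  using assms(2)
proof (induction s arbitrary: y)
  case (Suc s)
  have "y \<in> (\<lambda>(u, v). u @ v) ` (cube w \<times> cube (s * w))" using Suc.prems by (simp flip: cube_add)
  then obtain u' v' where y: "y = u' @ v'" and u': "u' \<in> cube w" and v': "v' \<in> cube (s * w)" by auto
  have "(\<Sum>x\<in>nontribes w (Suc s). tribes_kernel w (Suc s) x y)
      = (\<Sum>u\<in>cube w - {replicate w True}. \<Sum>v\<in>nontribes w s. tribes_kernel w (Suc s) (u @ v) y)"
    unfolding nontribes_Suc by (rule sum_append_product) auto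
  also have "\<dots> = (\<Sum>u\<in>cube w - {replicate w True}. \<Sum>v\<in>nontribes w s.
      block_kernel w u u' * tribes_kernel w s v v')"
    using u' by (simp add: y tribes_kernel_append del: tribes_kernel.simps)
  also have "\<dots> = 1"
    using Suc.IH[OF v'] block_kernel_col[OF assms(1) u'] by (simp add: sum_product[symmetric])
  finally show ?case .
qed simp

text \<open>With no all-ones block in the target, no block was raised. Hence exactly one unit of
  each row stays inside \<open>nontribes w s\<close>; the transport plan discards it.\<close>

lemma tribes_kernel_nontribes:
  assumes "x \<in> nontribes w s" "y \<in> nontribes w s"
  shows "tribes_kernel w s x y = (if x = y then 1 else 0)"
  using assms
proof (induction s arbitrary: x y)
  case (Suc s)
  obtain u v where x: "x = u @ v" and u: "u \<in> cube w - {replicate w True}"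
    and v: "v \<in> nontribes w s" using Suc.prems(1) by (auto simp: nontribes_Suc)
  obtain u' v' where y: "y = u' @ v'" and u': "u' \<in> cube w - {replicate w True}"
    and v': "v' \<in> nontribes w s" using Suc.prems(2) by (auto simp: nontribes_Suc)
  have "tribes_kernel w (Suc s) x y = block_kernel w u u' * tribes_kernel w s v v'"
    unfolding x y using u u' by (intro tribes_kernel_append) auto
  moreover have "x = y \<longleftrightarrow> u = u' \<and> v = v'" using u u' by (simp add: x y cube_def)
  ultimately show ?case using Suc.IH[OF v v'] u' by (auto simp: block_kernel_def)
qed simp

text \<open>The total mass is \<open>2 ^ (s * w)\<close>, so this says that an average of
  \<open>s / 2 ^ w\<close> blocks is raised, at a price of at most \<open>w\<close> each.\<close>

lemma tribes_kernel_cost: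
  assumes "w > 0"
  shows "(\<Sum>x\<in>nontribes w s. \<Sum>y\<in>cube (s * w). tribes_kernel w s x y * hamming_dist x y)
           \<le> real w * s * 2 ^ (s * w) / 2 ^ w"
proof (induction s)
  case (Suc s)
  let ?B = "cube w - {replicate w True}" and ?D = "nontribes w s" and ?C = "cube (s * w)"
  let ?k = "block_kernel w" and ?K = "tribes_kernel w s"
  \<comment> \<open>Distance is additive over the split and the kernel multiplicative, so the cost
    is cost times mass plus mass times cost.\<close>
  have inner: "(\<Sum>y\<in>cube (Suc s * w). tribes_kernel w (Suc s) (u @ v) y * hamming_dist (u @ v) y)
      = (\<Sum>u'\<in>cube w. ?k u u' * hamming_dist u u') * (\<Sum>v'\<in>?C. ?K v v')
        + (\<Sum>u'\<in>cube w. ?k u u') * (\<Sum>v'\<in>?C. ?K v v' * hamming_dist v v')"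
    if "u \<in> ?B" "v \<in> ?D" for u v
  proof -
    have "(\<Sum>y\<in>cube (Suc s * w). tribes_kernel w (Suc s) (u @ v) y * hamming_dist (u @ v) y)
      = (\<Sum>u'\<in>cube w. \<Sum>v'\<in>?C. ?k u u' * ?K v v' * hamming_dist (u @ v) (u' @ v'))"
      using that by (intro sum_kernel_append) auto
    also have "\<dots> = (\<Sum>u'\<in>cube w. \<Sum>v'\<in>?C. (?k u u' * hamming_dist u u') * ?K v v'
        + ?k u u' * (?K v v' * hamming_dist v v'))"
      using that by (intro sum.cong)
        (auto simp: cube_def nontribes_def hamming_dist_append algebra_simps)
    finally show ?thesis by (simp add: sum.distrib sum_product)
  qed
  \<comment> \<open>Both total masses are read off from the columns, each of which sums to
    1.\<close>
  have mass_k: "(\<Sum>u\<in>?B. \<Sum>u'\<in>cube w. ?k u u') = 2 ^ w"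
    using block_kernel_col[OF assms] by (subst sum.swap) (simp add: card_cube)
  have mass_K: "(\<Sum>v\<in>?D. \<Sum>v'\<in>?C. ?K v v') = 2 ^ (s * w)"
    using tribes_kernel_col[OF assms] by (subst sum.swap) (simp add: card_cube)
  have "(\<Sum>x\<in>nontribes w (Suc s). \<Sum>y\<in>cube (Suc s * w). tribes_kernel w (Suc s) x y * hamming_dist x y)
      = (\<Sum>u\<in>?B. \<Sum>v\<in>?D. \<Sum>y\<in>cube (Suc s * w).
          tribes_kernel w (Suc s) (u @ v) y * hamming_dist (u @ v) y)"
    unfolding nontribes_Suc by (rule sum_append_product) auto
  also have "\<dots> = (\<Sum>u\<in>?B. \<Sum>v\<in>?D.
      (\<Sum>u'\<in>cube w. ?k u u' * hamming_dist u u') * (\<Sum>v'\<in>?C. ?K v v')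
        + (\<Sum>u'\<in>cube w. ?k u u') * (\<Sum>v'\<in>?C. ?K v v' * hamming_dist v v'))"
    by (intro sum.cong refl inner)
  also have "\<dots> = (\<Sum>u\<in>?B. \<Sum>u'\<in>cube w. ?k u u' * hamming_dist u u') * (\<Sum>v\<in>?D. \<Sum>v'\<in>?C. ?K v v')
        + (\<Sum>u\<in>?B. \<Sum>u'\<in>cube w. ?k u u') * (\<Sum>v\<in>?D. \<Sum>v'\<in>?C. ?K v v' * hamming_dist v v')"
    by (simp only: sum.distrib sum_product[symmetric])
  also have "\<dots> \<le> w * 2 ^ (s * w) + 2 ^ w * (real w * s * 2 ^ (s * w) / 2 ^ w)"
    unfolding mass_k mass_K using Suc.IH block_kernel_cost[OF assms]
    by (intro add_mono mult_right_mono mult_left_mono) auto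
  also have "\<dots> = real w * Suc s * 2 ^ (Suc s * w) / 2 ^ w"
    by (simp add: field_simps power_add)
  finally show ?case .
qed simp

section \<open>The transport plan and the bijection it yields\<close>

text \<open>A transport plan from half the counting measure on the cube to the counting measure on a
  superset of the tribes set: one half of each tribes point stays put, one half of it is filled
  through the kernel, and the mass left over is spread evenly over the additional points.\<close>

definition tribes_plan :: "nat \<Rightarrow> nat \<Rightarrow> bool list \<Rightarrow> bool list \<Rightarrow> real" where
  "tribes_plan w s y z =
     (if z \<in> nontribes w s then (if y \<in> nontribes w s then 1 / card (nontribes w s) else 0)
      else if y \<in> nontribes w s then tribes_kernel w s y z / 2
      else if y = z then 1 / 2 else 0)"

lemma tribes_plan_nonneg: "tribes_plan w s y z \<ge> 0"
  by (simp add: tribes_plan_def tribes_kernel_nonneg)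

locale tribes_superset =
  fixes w s n :: nat and Y :: "bool list set"
  assumes w: "w > 0" and n: "n = s * w" "n > 0"
    and Y: "cube n - nontribes w s \<subseteq> Y" "Y \<subseteq> cube n" "card Y = 2 ^ (n - 1)"
begin

abbreviation D :: "bool list set" where "D \<equiv> nontribes w s"

lemma D_subset: "D \<subseteq> cube n"
  by (auto simp: nontribes_def n)

lemma card_D_pos: "card D > 0"
proof -
  have "real (card D) > 0" unfolding card_nontribes using w by simp
  then show ?thesis by simp
qed

text \<open>\<open>Y\<close> consists of everything outside \<open>D\<close> together with the extra
  points, and fills half the cube.\<close>

lemma card_extra: "real (card (Y \<inter> D)) = card D - 2 ^ n / 2"
proof -
  have "Y = (cube n - D) \<union> (Y \<inter> D)" using Y by auto
  then have "card Y = card ((cube n - D) \<union> (Y \<inter> D))" by simp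
  also have "\<dots> = card (cube n - D) + card (Y \<inter> D)"
    by (rule card_Un_disjoint) auto
  also have "card (cube n - D) = 2 ^ n - card D"
    using D_subset by (simp add: card_Diff_subset card_cube)
  finally have "2 ^ (n - 1) = 2 ^ n - card D + card (Y \<inter> D)" using Y(3) by simp
  \<comment> \<open>This makes the truncated subtraction exact before passing to the reals.\<close>
  moreover have "card D \<le> 2 ^ n" using card_mono[OF _ D_subset] by (simp add: card_cube)
  ultimately have "2 ^ (n - 1) + card D = 2 ^ n + card (Y \<inter> D)" by linarith
  then have "real (2 ^ (n - 1) + card D) = real (2 ^ n + card (Y \<inter> D))" by (rule arg_cong)
  moreover have "(2::real) ^ n = 2 * 2 ^ (n - 1)" using n(2) by (cases n) auto
  ultimately show ?thesis by simp
qed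

lemma sum_Y_split:
  fixes f :: "bool list \<Rightarrow> real"
  shows "sum f Y = sum f (cube n - D) + sum f (Y \<inter> D)"
proof -
  have "Y = (cube n - D) \<union> (Y \<inter> D)" using Y by auto
  then have "sum f Y = sum f ((cube n - D) \<union> (Y \<inter> D))" by simp
  also have "\<dots> = sum f (cube n - D) + sum f (Y \<inter> D)" by (rule sum.union_disjoint) auto
  finally show ?thesis .
qed

lemma sum_cube_split:
  fixes f :: "bool list \<Rightarrow> real"
  shows "sum f (cube n) = sum f (cube n - D) + sum f D"
  using D_subset by (intro sum.subset_diff) auto

text \<open>For \<open>y\<close> in \<open>D\<close> the kernel row has mass
  \<open>2 ^ n / card D\<close>. Discard the unit staying at \<open>y\<close> and halve the rest;
  the equal shares for the extra points then complete it to exactly one half, by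
  \<open>card_extra\<close>.\<close>

lemma tribes_plan_row:
  assumes "y \<in> cube n"
  shows "(\<Sum>z\<in>Y. tribes_plan w s y z) = 1 / 2"
proof (cases "y \<in> D")
  case True
  have "(\<Sum>z\<in>D. tribes_kernel w s y z) = (\<Sum>z\<in>D. if y = z then 1 else 0)"
    using True by (intro sum.cong) (auto simp: tribes_kernel_nontribes)
  then have one: "(\<Sum>z\<in>D. tribes_kernel w s y z) = 1" using True by simp
  have "(2::real) ^ n / card D = (2 ^ w / (2 ^ w - 1)) ^ s"
    unfolding card_nontribes n by (simp add: power_divide power_mult[symmetric] mult.commute)
  then have all: "(\<Sum>z\<in>cube n. tribes_kernel w s y z) = 2 ^ n / card D"
    using tribes_kernel_row[OF w True] n by simp
  have "(\<Sum>z\<in>Y. tribes_plan w s y z)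
      = (\<Sum>z\<in>cube n - D. tribes_kernel w s y z / 2) + (\<Sum>z\<in>Y \<inter> D. 1 / card D)"
    unfolding sum_Y_split using True
    by (intro arg_cong2[where f = "(+)"] sum.cong) (auto simp: tribes_plan_def)
  also have "\<dots> = (2 ^ n / card D - 1) / 2 + (card D - 2 ^ n / 2) / card D"
    using one all sum_cube_split[of "tribes_kernel w s y"] card_extra
    by (simp add: sum_divide_distrib[symmetric])
  also have "\<dots> = 1 / 2" using card_D_pos by (simp add: diff_divide_distrib card_gt_0_iff)
  finally show ?thesis .
next
  case False
  have "(\<Sum>z\<in>Y. tribes_plan w s y z) = (\<Sum>z\<in>cube n - D. if y = z then 1 / 2 else 0) + (\<Sum>z\<in>Y \<inter> D. 0)"
    unfolding sum_Y_split using False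
    by (intro arg_cong2[where f = "(+)"] sum.cong) (auto simp: tribes_plan_def)
  then show ?thesis using False assms by simp
qed

text \<open>An extra point collects \<open>card D\<close> equal shares. A tribes point gets one half
  from itself and one half from its kernel column, which sums to 1.\<close>

lemma tribes_plan_col:
  assumes "z \<in> Y"
  shows "(\<Sum>y\<in>cube n. tribes_plan w s y z) = 1"
proof (cases "z \<in> D")
  case True
  have "(\<Sum>y\<in>cube n. tribes_plan w s y z) = (\<Sum>y\<in>cube n - D. 0) + (\<Sum>y\<in>D. 1 / card D)"
    unfolding sum_cube_split using True
    by (intro arg_cong2[where f = "(+)"] sum.cong) (auto simp: tribes_plan_def)
  then show ?thesis using card_D_pos by (simp add: card_gt_0_iff)
next
  case False
  have "(\<Sum>y\<in>cube n. tribes_plan w s y z)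
      = (\<Sum>y\<in>cube n - D. if y = z then 1 / 2 else 0) + (\<Sum>y\<in>D. tribes_kernel w s y z / 2)"
    unfolding sum_cube_split using False
    by (intro arg_cong2[where f = "(+)"] sum.cong) (auto simp: tribes_plan_def)
  then show ?thesis
    using False assms Y(2) tribes_kernel_col[OF w, of z s] n
    by (auto simp: sum_divide_distrib[symmetric])
qed

text \<open>Mass starting outside \<open>D\<close> does not move. From \<open>D\<close>, the kernel
  part has half the kernel cost, and the mass sent to extra points is charged the maximal distance
  \<open>n\<close>.\<close>

lemma tribes_plan_cost:
  "(\<Sum>y\<in>cube n. \<Sum>z\<in>Y. tribes_plan w s y z * hamming_dist y z)
     \<le> real w * s * 2 ^ n / 2 ^ w / 2 + n * (card D - 2 ^ n / 2)"
proof -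
  let ?d = "\<lambda>y z. real (hamming_dist y z)"
  have "(\<Sum>z\<in>Y. tribes_plan w s y z * ?d y z) = 0" if "y \<in> cube n - D" for y
    using that by (intro sum.neutral) (auto simp: tribes_plan_def)
  then have "(\<Sum>y\<in>cube n. \<Sum>z\<in>Y. tribes_plan w s y z * ?d y z)
      = (\<Sum>y\<in>D. \<Sum>z\<in>Y. tribes_plan w s y z * ?d y z)"
    unfolding sum_cube_split by simp
  also have "\<dots> \<le> (\<Sum>y\<in>D. (\<Sum>z\<in>cube n. tribes_kernel w s y z * ?d y z) / 2
      + (card D - 2 ^ n / 2) * n / card D)"
  proof (rule sum_mono)
    fix y assume y: "y \<in> D"
    have "(\<Sum>z\<in>Y. tribes_plan w s y z * ?d y z)
        = (\<Sum>z\<in>cube n - D. tribes_kernel w s y z * ?d y z / 2) + (\<Sum>z\<in>Y \<inter> D. ?d y z / card D)"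
      unfolding sum_Y_split using y
      by (intro arg_cong2[where f = "(+)"] sum.cong) (auto simp: tribes_plan_def)
    also have "\<dots> \<le> (\<Sum>z\<in>cube n. tribes_kernel w s y z * ?d y z / 2) + (\<Sum>z\<in>Y \<inter> D. n / card D)"
    proof (intro add_mono sum_mono2 sum_mono divide_right_mono)
      fix z show "?d y z \<le> n"
        using hamming_dist_le_length[of y z] y D_subset by (auto simp: cube_def)
    qed (auto simp: tribes_kernel_nonneg)
    also have "\<dots> = (\<Sum>z\<in>cube n. tribes_kernel w s y z * ?d y z) / 2
      + (card D - 2 ^ n / 2) * n / card D"
      using card_extra by (simp add: sum_divide_distrib)
    finally show "(\<Sum>z\<in>Y. tribes_plan w s y z * ?d y z) \<le> \<dots>" .
  qed
  also have "\<dots> = (\<Sum>y\<in>D. \<Sum>z\<in>cube n. tribes_kernel w s y z * ?d y z) / 2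
      + n * (card D - 2 ^ n / 2)"
    using card_D_pos by (simp add: sum.distrib sum_divide_distrib card_gt_0_iff)
  also have "\<dots> \<le> real w * s * 2 ^ n / 2 ^ w / 2 + n * (card D - 2 ^ n / 2)"
    using tribes_kernel_cost[OF w, of s] n by simp
  finally show ?thesis .
qed

text \<open>Adding the half-unit rows of \<open>x @ [False]\<close> and \<open>x @ [True]\<close>
  gives a doubly stochastic matrix from the smaller cube to \<open>Y\<close>, so Birkhoff
  applies.\<close>

lemma tribes_bijection:
  "\<exists>\<phi>. bij_betw \<phi> (cube (n - 1)) Y \<and>
     (\<Sum>x\<in>cube (n - 1). real (hamming_dist (x @ [False]) (\<phi> x)))
       \<le> real w * s * 2 ^ n / 2 ^ w / 2 + n * (card D - 2 ^ n / 2) + 2 ^ n / 2"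
proof -
  let ?d = "\<lambda>y z. real (hamming_dist y z)"
  define P where "P = tribes_plan w s"
  define M where "M x z = P (x @ [False]) z + P (x @ [True]) z" for x z
  have sum_cube: "sum f (cube n) = (\<Sum>x\<in>cube (n - 1). f (x @ [False]) + f (x @ [True]))"
    for f :: "bool list \<Rightarrow> real"
  proof -
    have "cube n = (\<lambda>(u, v). u @ v) ` (cube (n - 1) \<times> cube 1)"
      using n(2) by (simp flip: cube_add)
    moreover have "cube 1 = {[False], [True]}"
      by (auto simp: cube_def length_Suc_conv)
    ultimately show ?thesis by (simp add: sum_append_product[of _ "n - 1"])
  qed
  have ext: "x @ [b] \<in> cube n" if "x \<in> cube (n - 1)" for x b
    using that n(2) by (simp add: cube_def)
  have "\<exists>\<phi>. bij_betw \<phi> (cube (n - 1)) Y \<and>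
      1 * (\<Sum>x\<in>cube (n - 1). ?d (x @ [False]) (\<phi> x))
        \<le> (\<Sum>x\<in>cube (n - 1). \<Sum>z\<in>Y. M x z * ?d (x @ [False]) z)"
  proof (rule birkhoff_min_cost)
    show "finite Y" using Y(2) by (rule finite_subset) simp
    show "M x z \<ge> 0" for x z by (simp add: M_def P_def tribes_plan_nonneg)
    show "(\<Sum>z\<in>Y. M x z) = 1" if "x \<in> cube (n - 1)" for x
      using tribes_plan_row[OF ext[OF that, of False]] tribes_plan_row[OF ext[OF that, of True]]
      by (simp add: M_def P_def sum.distrib)
    show "(\<Sum>x\<in>cube (n - 1). M x z) = 1" if "z \<in> Y" for z
      using tribes_plan_col[OF that] sum_cube[of "\<lambda>y. P y z"] by (simp add: M_def P_def)
  qed auto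
  moreover have "(\<Sum>x\<in>cube (n - 1). \<Sum>z\<in>Y. M x z * ?d (x @ [False]) z)
      \<le> real w * s * 2 ^ n / 2 ^ w / 2 + n * (card D - 2 ^ n / 2) + 2 ^ n / 2"
  proof -
    \<comment> \<open>Measuring from \<open>x @ [False]\<close> costs the mass of
      \<open>x @ [True]\<close> at most 1 more. The 1 is charged to both halves so that the sum runs
      uniformly over \<open>cube n\<close>; the total mass \<open>2 ^ n / 2\<close> is then the last
      term of the bound.\<close>
    have "(\<Sum>x\<in>cube (n - 1). \<Sum>z\<in>Y. M x z * ?d (x @ [False]) z)
      \<le> (\<Sum>x\<in>cube (n - 1). (\<Sum>z\<in>Y. P (x @ [False]) z * (?d (x @ [False]) z + 1))
          + (\<Sum>z\<in>Y. P (x @ [True]) z * (?d (x @ [True]) z + 1)))"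
      unfolding sum.distrib[symmetric]
    proof (intro sum_mono)
      fix x z
      have "hamming_dist (x @ [False]) z
          \<le> hamming_dist (x @ [False]) (x @ [True]) + hamming_dist (x @ [True]) z"
        by (rule hamming_dist_triangle) simp
      moreover have "hamming_dist (x @ [False]) (x @ [True]) = 1"
        by (simp add: hamming_dist_append) (simp add: hamming_dist_conv_filter)
      ultimately have "?d (x @ [False]) z \<le> ?d (x @ [True]) z + 1" by linarith
      then have "P (x @ [True]) z * ?d (x @ [False]) z \<le> P (x @ [True]) z * (?d (x @ [True]) z + 1)"
        by (intro mult_left_mono) (auto simp: P_def tribes_plan_nonneg)
      moreover have "P (x @ [False]) z \<ge> 0" by (simp add: P_def tribes_plan_nonneg)
      ultimately show "M x z * ?d (x @ [False]) z
        \<le> P (x @ [False]) z * (?d (x @ [False]) z + 1) + P (x @ [True]) z * (?d (x @ [True]) z + 1)"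
        by (simp add: M_def algebra_simps)
    qed
    also have "\<dots> = (\<Sum>y\<in>cube n. \<Sum>z\<in>Y. P y z * (?d y z + 1))" by (rule sum_cube[symmetric])
    also have "\<dots> = (\<Sum>y\<in>cube n. \<Sum>z\<in>Y. P y z * ?d y z) + (\<Sum>y\<in>cube n. \<Sum>z\<in>Y. P y z)"
      by (simp add: algebra_simps sum.distrib)
    also have "(\<Sum>y\<in>cube n. \<Sum>z\<in>Y. P y z) = (\<Sum>y\<in>cube n. 1 / 2)"
      unfolding P_def by (intro sum.cong refl tribes_plan_row)
    finally show ?thesis using tribes_plan_cost by (simp add: P_def card_cube)
  qed
  ultimately show ?thesis by force
qed

end

section \<open>Threshold estimates and the final bound\<close>

lemma tribes_threshold_bounds:
  assumes "w > 0" "tribes_threshold w s"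
  shows "real s \<le> 2 ^ w" and "(1 - 1 / 2 ^ w) ^ s \<le> (1 / 2 + 1 / 2 ^ w :: real)" and "2 ^ w \<le> 2 * s"
proof -
  define p :: real where "p = 1 / 2 ^ w"
  have p: "0 < p" "p < 1" using assms(1) by (auto simp: p_def)
  have half: "(1 - p) ^ s \<ge> 1 / 2"
    using assms(2) by (auto simp: tribes_threshold_def p_def)
  have "\<not> 1 - (1 - p) ^ Suc s \<le> 1 / 2"
    using assms(2) unfolding tribes_threshold_def p_def by (meson Suc_n_not_le_n)
  \<comment> \<open>Maximality of \<open>s\<close>: one more block crosses the threshold. Since one
    factor \<open>1 - p\<close> changes the power by at most \<open>p\<close>, the density of
    \<open>nontribes w s\<close> exceeds one half by at most \<open>p\<close>.\<close>
  then have lt: "(1 - p) ^ Suc s < 1 / 2" by simp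
  have "(1 - p) ^ s \<le> exp (- p) ^ s"
    using p exp_ge_add_one_self[of "- p"] by (intro power_mono) auto
  also have "\<dots> = exp (- (s * p))" by (simp add: exp_of_nat_mult[symmetric])
  \<comment> \<open>Hence \<open>s * p\<close> is at most \<open>ln 2\<close>; the cruder bound 1
    suffices.\<close>
  finally have "1 / 2 \<le> exp (- (s * p))" using half by linarith
  then have "exp (s * p) \<le> 2" by (simp add: exp_minus field_simps)
  also have "(2::real) \<le> exp 1" using exp_ge_add_one_self[of 1] by simp
  finally have "s * p \<le> 1" by simp
  then show "real s \<le> 2 ^ w" by (simp add: p_def field_simps)
  have "(1 - p) ^ s - p * (1 - p) ^ s < 1 / 2" using lt by (simp add: algebra_simps)
  moreover have "p * (1 - p) ^ s \<le> p * 1" using p by (intro mult_left_mono power_le_one) auto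
  ultimately show "(1 - 1 / 2 ^ w) ^ s \<le> (1 / 2 + 1 / 2 ^ w :: real)" by (simp add: p_def)
  have "1 + real (Suc s) * (- p) \<le> (1 + - p) ^ Suc s"
    using p by (intro Bernoulli_inequality) auto
  then have "Suc s * p > 1 / 2" using lt by simp
  then have "2 ^ w < 2 * real (Suc s)" by (simp add: p_def field_simps)
  then have "real (2 ^ w) < real (2 * Suc s)" by simp
  then have "2 ^ w < 2 * Suc s" by (simp only: of_nat_less_iff)
  \<comment> \<open>Bernoulli only gives \<open>2 ^ w < 2 * s + 2\<close>; as \<open>2 ^ w\<close>
    is even, this improves to \<open>2 ^ w \<le> 2 * s\<close>.\<close>
  moreover obtain k :: nat where "2 ^ w = 2 * k" using assms(1) by (cases w) auto
  ultimately show "2 ^ w \<le> 2 * s" by simp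
qed

theorem theorem4:
  shows "\<exists>C::real. C > 0 \<and>
    (\<forall>(w::nat) (s::nat) (n::nat) (A::bool list set) (Astar::bool list set).
       w > 0 \<longrightarrow> tribes_threshold w s \<longrightarrow> n = s * w \<longrightarrow> n > 1 \<longrightarrow>
       A = {x \<in> cube n. tribes w s x} \<longrightarrow>
       A \<subseteq> Astar \<longrightarrow> Astar \<subseteq> cube n \<longrightarrow> card Astar = 2 ^ (n - 1) \<longrightarrow>
       (\<exists>\<phi>. bij_betw \<phi> (cube (n - 1)) Astar \<and>
            measure_pmf.expectation (pmf_of_set (cube (n - 1)))
              (\<lambda>x. real (hamming_dist (x @ [False]) (\<phi> x))) \<le> C * log 2 (real n) \<and>
            avgstretch (n - 1) \<phi> \<le> 2 * C * log 2 (real n) + 1))"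
proof (intro exI[of _ 8] conjI allI impI)
  \<comment> \<open>The constant 8: the average displacement is at most \<open>3 * w + 1\<close>,
    hence at most \<open>4 * w\<close>, and \<open>w\<close> is at most
    \<open>2 * log 2 n\<close>.\<close>
  fix w s n :: nat and A Astar :: "bool list set"
  assume w: "w > 0" and thr: "tribes_threshold w s" and n: "n = s * w" "n > 1"
    and A: "A = {x \<in> cube n. tribes w s x}"
    and Astar: "A \<subseteq> Astar" "Astar \<subseteq> cube n" "card Astar = 2 ^ (n - 1)"
  interpret T: tribes_superset w s n Astar
    using w n(1) A Astar order.strict_trans[OF zero_less_one n(2)]
    by unfold_locales (auto simp: nontribes_def)
  note bounds = tribes_threshold_bounds[OF w thr]
  have two_n: "(2::real) ^ n = 2 * 2 ^ (n - 1)" using n(2) by (cases n) auto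
  obtain \<phi> where \<phi>: "bij_betw \<phi> (cube (n - 1)) Astar"
    and cost: "(\<Sum>x\<in>cube (n - 1). real (hamming_dist (x @ [False]) (\<phi> x)))
       \<le> real w * s * 2 ^ n / 2 ^ w / 2 + n * (card (nontribes w s) - 2 ^ n / 2) + 2 ^ n / 2"
    using T.tribes_bijection by blast
  define E where "E = measure_pmf.expectation (pmf_of_set (cube (n - 1)))
    (\<lambda>x. real (hamming_dist (x @ [False]) (\<phi> x)))"
  have "cube (n - 1) \<noteq> {}" using card_cube[of "n - 1"] by auto
  then have E: "E * 2 ^ (n - 1) = (\<Sum>x\<in>cube (n - 1). real (hamming_dist (x @ [False]) (\<phi> x)))"
    by (simp add: E_def integral_pmf_of_set card_cube)
  have s_ratio: "real s / 2 ^ w \<le> 1" using bounds(1) by simp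
  have "real (card (nontribes w s)) / 2 ^ n = (1 - 1 / 2 ^ w) ^ s"
    unfolding card_nontribes n
    by (simp add: power_mult mult.commute[of s w] diff_divide_distrib flip: power_divide)
  also have "\<dots> \<le> 1 / 2 + 1 / 2 ^ w" by (rule bounds(2))
  finally have "real (card (nontribes w s)) \<le> (1 / 2 + 1 / 2 ^ w) * 2 ^ n" by (simp add: pos_divide_le_eq)
  \<comment> \<open>Although \<open>n = s * w\<close> may be of order \<open>w * 2 ^ w\<close>, the
    extra points have density at most \<open>1 / 2 ^ w\<close>, which leaves
    \<open>O(w)\<close>.\<close>
  then have "n * (card (nontribes w s) - 2 ^ n / 2) \<le> n * (2 ^ n / 2 ^ w)"
    by (intro mult_left_mono) (auto simp: algebra_simps)
  also have "\<dots> = (real s / 2 ^ w) * (real w * 2 ^ n)" by (simp add: n)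
  also have "\<dots> \<le> 1 * (real w * 2 ^ n)" using s_ratio by (intro mult_right_mono) auto
  finally have c2: "n * (card (nontribes w s) - 2 ^ n / 2) \<le> w * 2 ^ n" by simp
  have "real w * s * 2 ^ n / 2 ^ w / 2 = (real s / 2 ^ w) * (w * 2 ^ n / 2)" by simp
  also have "\<dots> \<le> 1 * (w * 2 ^ n / 2)" using s_ratio by (intro mult_right_mono) auto
  finally have c1: "real w * s * 2 ^ n / 2 ^ w / 2 \<le> w * 2 ^ n / 2" by simp
  have "E * 2 ^ (n - 1) \<le> w * 2 ^ n / 2 + w * 2 ^ n + 2 ^ n / 2"
    using E cost c1 c2 by linarith
  also have "\<dots> = (3 * real w + 1) * 2 ^ (n - 1)" by (simp add: two_n algebra_simps)
  finally have "E \<le> 3 * real w + 1" by (rule mult_right_le_imp_le) simp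
  also have "\<dots> \<le> 4 * real w" using w by simp
  also have "\<dots> \<le> 8 * log 2 n"
  proof -
    have "2 * 2 ^ (w - 1) \<le> 2 * s" using bounds(3) w by (cases w) auto
    then have "2 ^ (w - 1) \<le> s" by simp
    also have "s \<le> n" using w n by simp
    finally have "real (2 ^ (w - 1)) \<le> real n" by (simp only: of_nat_le_iff)
    then have "log 2 (2 ^ (w - 1)) \<le> log 2 n" using n(2) by (subst log_le_cancel_iff) auto
    then have "real (w - 1) \<le> log 2 n" by (simp add: log_nat_power)
    \<comment> \<open>Here \<open>n > 1\<close> matters: it absorbs the off-by-one in
      \<open>w - 1 \<le> log 2 n\<close>.\<close>
    moreover have "1 \<le> log 2 n" using n(2) by (simp add: le_log_iff)
    ultimately show ?thesis using w by (simp add: of_nat_diff)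
  qed
  finally have E_le: "E \<le> 8 * log 2 n" .
  have "\<phi> x \<in> cube (Suc (n - 1))" if "x \<in> cube (n - 1)" for x
    using \<phi> that Astar(2) n(2) by (auto simp: bij_betw_def)
  then have "avgstretch (n - 1) \<phi> \<le> 2 * E + 1"
    unfolding E_def using n(2) by (intro avgstretch_le_twice_avg_displacement) auto
  then have "avgstretch (n - 1) \<phi> \<le> 2 * 8 * log 2 n + 1" using E_le by simp
  then show "\<exists>\<phi>. bij_betw \<phi> (cube (n - 1)) Astar \<and>
      measure_pmf.expectation (pmf_of_set (cube (n - 1)))
        (\<lambda>x. real (hamming_dist (x @ [False]) (\<phi> x))) \<le> 8 * log 2 (real n) \<and>
      avgstretch (n - 1) \<phi> \<le> 2 * 8 * log 2 (real n) + 1"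
    using \<phi> E_le unfolding E_def by blast
qed simp

end
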